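(* Let $d\ge 1$, let $Q_1,\dots,Q_{L_q}\in\mathbb{R}^d$ (queries) and $K_1,\dots,K_{L_k}\in\mathbb{R}^d$ (keys), partitioned into query blocks with index sets $I(g_q)$, $g_q=1,\dots,N_q$, and key blocks with index sets $J(g_k)$, $g_k=1,\dots,N_k$. For every query block $g_q$ and key block $g_k$, put $$U_{g_q,g_k}=\frac{R^Q_{g_q}M^K_{g_k}+M^Q_{g_q}R^K_{g_k}+R^Q_{g_q}R^K_{g_k}}{\sqrt d}.$$ Then for all $i\in I(g_q)$ and all $j\in J(g_k)$, the token-level logit $\hat\ell_{ij}$ and the block-level logit $\ell_{g_q,g_k}$ satisfy $$\big|\hat\ell_{ij}-\ell_{g_q,g_k}\big|\le U_{g_q,g_k}.$$
   Context: The index sets $I(g_q)\subseteq\{1,\dots,L_q\}$ and $J(g_k)\subseteq\{1,\dots,L_k\}$ are the nonempty blocks of token indices, each of size $B$, with $N_q=L_q/B$ and $N_k=L_k/B$. The block means (mean pooling) are $\bar Q_{g_q}=\frac{1}{|I(g_q)|}\sum_{i\in I(g_q)}Q_i$ and $\bar K_{g_k}=\frac{1}{|J(g_k)|}\sum_{j\in J(g_k)}K_j$. The token-level logit is $\hat\ell_{ij}=(Q_i\cdot K_j)/\sqrt d$ and the block-level logit is $\ell_{g_q,g_k}=(\bar Q_{g_q}\cdot\bar K_{g_k})/\sqrt d$, where $\cdot$ is the Euclidean inner product on $\mathbb{R}^d$. The block radii and max norms are $$R^Q_{g_q}=\max_{i\in I(g_q)}\|Q_i-\bar Q_{g_q}\|_2,\quad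 M^Q_{g_q}=\max_{i\in I(g_q)}\|Q_i\|_2,\quad R^K_{g_k}=\max_{j\in J(g_k)}\|K_j-\bar K_{g_k}\|_2,\quad M^K_{g_k}=\max_{j\in J(g_k)}\|K_j\|_2.$$ *)

theory Defs
  imports "HOL-Analysis.Analysis"
begin

(* Blocks need not be contiguous ranges of token indices. *)
definition block_partition :: "nat \<Rightarrow> nat \<Rightarrow> nat \<Rightarrow> (nat \<Rightarrow> nat set) \<Rightarrow> bool" where
  "block_partition L B N S \<longleftrightarrow>
     0 < B \<and> real N = real L / real B \<and>
     (\<Union>g\<in>{1..N}. S g) = {1..L} \<and>
     disjoint_family_on S {1..N} \<and>
     (\<forall>g\<in>{1..N}. S g \<noteq> {} \<and> card (S g) = B)"

definition block_mean :: "(nat \<Rightarrow> real ^ 'd) \<Rightarrow> nat set \<Rightarrow> real ^ 'd" where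
  "block_mean X S = (1 / real (card S)) *\<^sub>R (\<Sum>i\<in>S. X i)"

definition block_radius :: "(nat \<Rightarrow> real ^ 'd) \<Rightarrow> nat set \<Rightarrow> real" where
  "block_radius X S = Max ((\<lambda>i. norm (X i - block_mean X S)) ` S)"

definition block_max_norm :: "(nat \<Rightarrow> real ^ 'd) \<Rightarrow> nat set \<Rightarrow> real" where
  "block_max_norm X S = Max ((\<lambda>i. norm (X i)) ` S)"

definition token_logit ::
  "(nat \<Rightarrow> real ^ 'd) \<Rightarrow> (nat \<Rightarrow> real ^ 'd) \<Rightarrow> nat \<Rightarrow> nat \<Rightarrow> real" where
  "token_logit Q K i j = (Q i \<bullet> K j) / sqrt (real CARD('d))"

definition block_logit ::
  "(nat \<Rightarrow> real ^ 'd) \<Rightarrow> (nat \<Rightarrow> real ^ 'd) \<Rightarrow> nat set \<Rightarrow> nat set \<Rightarrow> real" where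
  "block_logit Q K S T = (block_mean Q S \<bullet> block_mean K T) / sqrt (real CARD('d))"

definition logit_bound ::
  "(nat \<Rightarrow> real ^ 'd) \<Rightarrow> (nat \<Rightarrow> real ^ 'd) \<Rightarrow> nat set \<Rightarrow> nat set \<Rightarrow> real" where
  "logit_bound Q K S T =
     (block_radius Q S * block_max_norm K T
      + block_max_norm Q S * block_radius K T
      + block_radius Q S * block_radius K T) / sqrt (real CARD('d))"

end

(* Writing q', k' for the block means, the mixed second-order term is subtracted rather than added:
   q . k - q' . k' = (q - q') . k + q . (k - k') - (q - q') . (k - k').
   Every factor is then a token norm or a token deviation, so no bound on the norms of the means
   is needed. *)
theory Submission
  imports Defs
begin

lemma abs_inner_diff_le:
  fixes q k q' k' :: "'a::real_inner"
  assumes "norm (q - q') \<le> r" "norm q \<le> m" "norm (k - k') \<le> s" "norm k \<le> n"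
  shows "\<bar>q \<bullet> k - q' \<bullet> k'\<bar> \<le> r * n + m * s + r * s"
proof -
  \<comment> \<open>\<open>mult_mono'\<close> asks for nonnegativity of the smaller factors only;
    these are norms, so \<open>simp\<close> discharges it.\<close>
  have cs: "\<bar>x \<bullet> y\<bar> \<le> a * b" if "norm x \<le> a" "norm y \<le> b" for x y :: 'a and a b
    using Cauchy_Schwarz_ineq2[of x y] mult_mono'[OF that] by simp
  have "q \<bullet> k - q' \<bullet> k' = (q - q') \<bullet> k + q \<bullet> (k - k') - (q - q') \<bullet> (k - k')"
    by (simp add: inner_diff_left inner_diff_right)
  then show ?thesis
    using cs[OF assms(1,4)] cs[OF assms(2,3)] cs[OF assms(1,3)] by linarith
qed

lemma norm_diff_block_mean_le:
  assumes "finite S" "i \<in> S"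
  shows "norm (X i - block_mean X S) \<le> block_radius X S"
  unfolding block_radius_def using assms by (intro Max_ge) auto

lemma norm_le_block_max_norm:
  assumes "finite S" "i \<in> S"
  shows "norm (X i) \<le> block_max_norm X S"
  unfolding block_max_norm_def using assms by (intro Max_ge) auto

lemma abs_token_logit_diff_block_logit_le:
  assumes "finite S" "i \<in> S" "finite T" "j \<in> T"
  shows "\<bar>token_logit Q K i j - block_logit Q K S T\<bar> \<le> logit_bound Q K S T"
  \<comment> \<open>Both logits and the bound share the denominator
    \<open>sqrt (real CARD('d))\<close>. Merging the difference into one fraction leaves a
    comparison of numerators, which is \<open>abs_inner_diff_le\<close>.\<close>
  unfolding token_logit_def block_logit_def logit_bound_def diff_divide_distrib[symmetric] abs_divide
  using assms
  by (simp add: divide_right_mono abs_inner_diff_le norm_diff_block_mean_le norm_le_block_max_norm)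

text \<open>An infinite set has \<open>card\<close> 0, whereas blocks have size \<open>B\<close> >
  0. Finiteness is what makes \<open>Max\<close> an upper bound over a block.\<close>

lemma block_partition_finite:
  assumes "block_partition L B N S" "g \<in> {1..N}"
  shows "finite (S g)"
  using assms unfolding block_partition_def by (metis card_ge_0_finite)

theorem mainTheorem1:
  fixes Q K :: "nat \<Rightarrow> real ^ 'd"
    and I J :: "nat \<Rightarrow> nat set"
    and L\<^sub>q L\<^sub>k B N\<^sub>q N\<^sub>k :: nat
  assumes "block_partition L\<^sub>q B N\<^sub>q I"
    and "block_partition L\<^sub>k B N\<^sub>k J"
  shows "\<forall>g\<^sub>q\<in>{1..N\<^sub>q}. \<forall>g\<^sub>k\<in>{1..N\<^sub>k}. \<forall>i\<in>I g\<^sub>q. \<forall>j\<in>J g\<^sub>k.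
    \<bar>token_logit Q K i j - block_logit Q K (I g\<^sub>q) (J g\<^sub>k)\<bar>
      \<le> logit_bound Q K (I g\<^sub>q) (J g\<^sub>k)"
  using block_partition_finite[OF assms(1)] block_partition_finite[OF assms(2)]
  by (blast intro: abs_token_logit_diff_block_logit_le)

end
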